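(* Let a Lie group $G$ act smoothly on a two-dimensional manifold $M$ with local coordinates $(x,u)$, and let $\gamma(\varepsilon)$ be a smooth curve in $G$ with $\gamma(0)=e$. Let $k\ge 0$, let $(x_i,u_i)$, $i=0,\dots,k+1$, be points with $x_0,\dots,x_{k+1}$ pairwise distinct, and put $(\widetilde{x}_i,\widetilde{u}_i)=\gamma(\varepsilon)\cdot(x_i,u_i)$. Then the infinitesimals $\hat{\varphi}^{(j)}_{[j]}=\left.\frac{d}{d\varepsilon}\right|_{\varepsilon=0}\hat{\widetilde{u}}^{(j)}$ of the group action on the multispace of one independent variable satisfy the recursion relation $$\hat{\varphi}^{(k+1)}_{[k+1]} = \frac{\Delta}{\Delta x}\Bigl[\hat{\varphi}^{(k)}_{[k]}\Bigr] - \hat{u}^{(k+1)}\left(\frac{1}{x_{k+1}-x_0}\,\bigl(S^{k+1}-\mathrm{id}\bigr)\bigl[\hat{\xi}^{(0)}\bigr]\right).$$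
   Context: For points $x_0,\dots,x_j\in\mathbb{R}$, $\Delta^{(j)}$ denotes the determinant of the $(j+1)\times(j+1)$ Vandermonde matrix whose $i$-th row is $(1,x_i,x_i^2,\dots,x_i^j)$, $i=0,\dots,j$. For a quantity $w$ with values $w_0,\dots,w_j$ at the sample points, $\Delta^{(j)}(w,x^j)$ denotes the determinant of the matrix obtained by replacing the last column $(x_0^j,\dots,x_j^j)^T$ by $(w_0,\dots,w_j)^T$. For pairwise distinct $x_0,\dots,x_j$ define $$\hat{w}^{(j)} := j!\,\frac{\Delta^{(j)}(w,x^j)}{\Delta^{(j)}},$$ i.e. $j!$ times the $j$-th divided difference of $w$ at $x_0,\dots,x_j$. The transformed coordinate $\hat{\widetilde{u}}^{(j)}$ is given by the same formula with all $(x_i,u_i)$ replaced by $(\widetilde{x}_i,\widetilde{u}_i)$ (defined for $\varepsilon$ near $0$). Writing $(\widetilde{x}(x,u;\varepsilon),\widetilde{u}(x,u;\varepsilon))=\gamma(\varepsilon)\cdot(x,u)$, set $\xi(x,u)=\left.\frac{d}{d\varepsilon}\right|_{\varepsilon=0}\widetilde{x}$. Then $\hat{\xi}^{(0)}=\xi(x_0,u_0)$. The shift operator $S$ increments all subscripts by $1$: $S[x_i]=x_{i+1}$, $S[u_i]=u_{i+1}$; an expression depending on the points with indices $0,\dots,k$ is sent to the same expression in the points with indices $1,\dots,k+1$. In particular $S^{k+1}[\hat{\xi}^{(0)}]=\xi(x_{k+1},u_{k+1})$. For an expression $w_{0,\dots,k}$ depending on the points with indices $0,\dots,k$, the discrete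 derivative is $$\frac{\Delta}{\Delta x}[w_{0,\dots,k}] := \frac{k+1}{x_{k+1}-x_0}\,(S-\mathrm{id})[w_{0,\dots,k}].$$ Here $\hat{\varphi}^{(k)}_{[k]}$ is regarded as an expression in the points with indices $0,\dots,k$. *)

theory Defs
  imports
    "HOL-Analysis.Analysis"
    "HOL-Algebra.Group_Action"
    "Jordan_Normal_Form.Determinant"
begin

section \<open>Smooth maps\<close>

text \<open>\<open>Ck_on n W f\<close> is the usual class \<open>C^n\<close> and is only meant for open \<open>W\<close>.\<close>

primrec Ck_on ::
  "nat \<Rightarrow> 'a::real_normed_vector set \<Rightarrow> ('a \<Rightarrow> 'b::real_normed_vector) \<Rightarrow> bool" where
  "Ck_on 0 W f \<longleftrightarrow> continuous_on W f"
| "Ck_on (Suc n) W f \<longleftrightarrow>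
     (\<forall>x\<in>W. f differentiable (at x)) \<and> (\<forall>v. Ck_on n W (\<lambda>x. frechet_derivative f (at x) v))"

text \<open>A map on an arbitrary subset of a Euclidean space is smooth if it extends locally to
  a smooth map on an open set. This is needed because charts below take values in a linear
  subspace; for open \<open>S\<close> it is ordinary smoothness.\<close>

definition smooth_on :: "'a::euclidean_space set \<Rightarrow> ('a \<Rightarrow> 'b::euclidean_space) \<Rightarrow> bool" where
  "smooth_on S f \<longleftrightarrow>
     (\<forall>x\<in>S. \<exists>W F. open W \<and> x \<in> W \<and> (\<forall>n. Ck_on n W F) \<and> (\<forall>y\<in>S \<inter> W. f y = F y))"

section \<open>Smooth manifolds\<close>

text \<open>A chart is a pair \<open>(U, \<phi>)\<close>. The model space is a linear subspace of the Euclidean type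
  \<open>'e\<close>, so that dimension 0 (hence discrete Lie groups) is included.\<close>

record ('a, 'e) manifold =
  top_of :: "'a topology"
  model :: "'e set"
  atlas :: "('a set \<times> ('a \<Rightarrow> 'e)) set"

definition is_chart :: "('a, 'e::euclidean_space) manifold \<Rightarrow> 'a set \<Rightarrow> ('a \<Rightarrow> 'e) \<Rightarrow> bool" where
  "is_chart M U \<phi> \<longleftrightarrow>
     openin (top_of M) U \<and> openin (top_of_set (model M)) (\<phi> ` U) \<and>
     homeomorphic_map (subtopology (top_of M) U) (top_of_set (\<phi> ` U)) \<phi>"

definition smoothly_compatible ::
  "'a set \<Rightarrow> ('a \<Rightarrow> 'e::euclidean_space) \<Rightarrow> 'a set \<Rightarrow> ('a \<Rightarrow> 'e) \<Rightarrow> bool" where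
  "smoothly_compatible U \<phi> V \<psi> \<longleftrightarrow>
     smooth_on (\<phi> ` (U \<inter> V)) (\<psi> \<circ> inv_into U \<phi>) \<and>
     smooth_on (\<psi> ` (U \<inter> V)) (\<phi> \<circ> inv_into V \<psi>)"

definition smooth_manifold :: "('a, 'e::euclidean_space) manifold \<Rightarrow> bool" where
  "smooth_manifold M \<longleftrightarrow>
     Hausdorff_space (top_of M) \<and> second_countable (top_of M) \<and> subspace (model M) \<and>
     (\<forall>(U, \<phi>)\<in>atlas M. is_chart M U \<phi>) \<and>
     topspace (top_of M) = (\<Union>(U, \<phi>)\<in>atlas M. U) \<and>
     (\<forall>(U, \<phi>)\<in>atlas M. \<forall>(V, \<psi>)\<in>atlas M. smoothly_compatible U \<phi> V \<psi>)"

text \<open>Local coordinates: a chart of the maximal atlas, not necessarily a member of the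
  chosen atlas.\<close>

definition local_coordinates ::
  "('a, 'e::euclidean_space) manifold \<Rightarrow> 'a set \<Rightarrow> ('a \<Rightarrow> 'e) \<Rightarrow> bool" where
  "local_coordinates M U \<phi> \<longleftrightarrow>
     is_chart M U \<phi> \<and> (\<forall>(V, \<psi>)\<in>atlas M. smoothly_compatible U \<phi> V \<psi>)"

definition smooth_map ::
  "('a, 'e::euclidean_space) manifold \<Rightarrow> ('b, 'f::euclidean_space) manifold \<Rightarrow> ('a \<Rightarrow> 'b) \<Rightarrow> bool"
  where
  "smooth_map M N f \<longleftrightarrow>
     continuous_map (top_of M) (top_of N) f \<and>
     (\<forall>(U, \<phi>)\<in>atlas M. \<forall>(V, \<psi>)\<in>atlas N.
        smooth_on (\<phi> ` (U \<inter> f -` V)) (\<psi> \<circ> f \<circ> inv_into U \<phi>))"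

definition prod_manifold ::
  "('a, 'e) manifold \<Rightarrow> ('b, 'f) manifold \<Rightarrow> ('a \<times> 'b, 'e \<times> 'f) manifold" where
  "prod_manifold M N =
     \<lparr>top_of = prod_topology (top_of M) (top_of N),
      model = model M \<times> model N,
      atlas = {(U \<times> V, map_prod \<phi> \<psi>) | U \<phi> V \<psi>. (U, \<phi>) \<in> atlas M \<and> (V, \<psi>) \<in> atlas N}\<rparr>"

definition open_line :: "real set \<Rightarrow> (real, real) manifold" where
  "open_line J = \<lparr>top_of = top_of_set J, model = UNIV, atlas = {(J, id)}\<rparr>"

section \<open>Lie groups and smooth actions\<close>

definition lie_group ::
  "('g, 'c) monoid_scheme \<Rightarrow> ('g, 'e::euclidean_space) manifold \<Rightarrow> bool" where
  "lie_group G L \<longleftrightarrow>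
     group G \<and> smooth_manifold L \<and> topspace (top_of L) = carrier G \<and>
     smooth_map (prod_manifold L L) L (\<lambda>(g, h). g \<otimes>\<^bsub>G\<^esub> h) \<and>
     smooth_map L L (\<lambda>g. inv\<^bsub>G\<^esub> g)"

definition smooth_action ::
  "('g, 'c) monoid_scheme \<Rightarrow> ('g, 'e::euclidean_space) manifold \<Rightarrow>
   ('m, 'f::euclidean_space) manifold \<Rightarrow> ('g \<Rightarrow> 'm \<Rightarrow> 'm) \<Rightarrow> bool" where
  "smooth_action G L M act \<longleftrightarrow>
     group_action G (topspace (top_of M)) act \<and>
     smooth_map (prod_manifold L M) M (\<lambda>(g, p). act g p)"

text \<open>\<open>moved act U \<phi> \<gamma> \<epsilon> (x, u)\<close> is the pair of coordinates of the point
  \<open>\<gamma>(\<epsilon>) \<cdot> (x, u)\<close>. For \<open>(x, u) \<in> \<phi> ` U\<close> and \<open>\<epsilon>\<close> near 0 this point lies in the coordinate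
  domain \<open>U\<close>; otherwise the value is meaningless.\<close>

definition moved ::
  "('g \<Rightarrow> 'm \<Rightarrow> 'm) \<Rightarrow> 'm set \<Rightarrow> ('m \<Rightarrow> real \<times> real) \<Rightarrow> (real \<Rightarrow> 'g) \<Rightarrow>
   real \<Rightarrow> real \<times> real \<Rightarrow> real \<times> real" where
  "moved act U \<phi> \<gamma> \<epsilon> p = \<phi> (act (\<gamma> \<epsilon>) (inv_into U \<phi> p))"

section \<open>Multispace coordinates\<close>

definition vandermonde_det :: "nat \<Rightarrow> (nat \<Rightarrow> real) \<Rightarrow> real" where
  "vandermonde_det j x = Determinant.det (Matrix.mat (j + 1) (j + 1) (\<lambda>(i, c). x i ^ c))"

definition vandermonde_det_repl :: "nat \<Rightarrow> (nat \<Rightarrow> real) \<Rightarrow> (nat \<Rightarrow> real) \<Rightarrow> real" where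
  "vandermonde_det_repl j w x =
     Determinant.det (Matrix.mat (j + 1) (j + 1) (\<lambda>(i, c). if c = j then w i else x i ^ c))"

definition hat :: "nat \<Rightarrow> (nat \<Rightarrow> real) \<Rightarrow> (nat \<Rightarrow> real) \<Rightarrow> real" where
  "hat j w x = fact j * (vandermonde_det_repl j w x / vandermonde_det j x)"

text \<open>An expression in the sample points is a function of the whole sequence
  \<open>z i = (x\<^sub>i, u\<^sub>i)\<close>; one in the points with indices \<open>0, \<dots>, k\<close> uses only \<open>z 0, \<dots>, z k\<close>.\<close>

type_synonym expression = "(nat \<Rightarrow> real \<times> real) \<Rightarrow> real"

definition shift :: "expression \<Rightarrow> expression" where
  "shift w = (\<lambda>z. w (\<lambda>i. z (i + 1)))"

definition discrete_deriv :: "nat \<Rightarrow> expression \<Rightarrow> expression" where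
  "discrete_deriv k w =
     (\<lambda>z. real (k + 1) / (fst (z (k + 1)) - fst (z 0)) * (shift w z - w z))"

definition u_hat :: "nat \<Rightarrow> expression" where
  "u_hat j z = hat j (\<lambda>i. snd (z i)) (\<lambda>i. fst (z i))"

text \<open>In the following, \<open>T \<epsilon> (x, u)\<close> stands for the transformed coordinates.\<close>

definition phi_hat :: "(real \<Rightarrow> real \<times> real \<Rightarrow> real \<times> real) \<Rightarrow> nat \<Rightarrow> expression" where
  "phi_hat T j z = deriv (\<lambda>\<epsilon>. u_hat j (\<lambda>i. T \<epsilon> (z i))) 0"

definition xi :: "(real \<Rightarrow> real \<times> real \<Rightarrow> real \<times> real) \<Rightarrow> real \<times> real \<Rightarrow> real" where
  "xi T p = deriv (\<lambda>\<epsilon>. fst (T \<epsilon> p)) 0"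

definition xi_hat :: "(real \<Rightarrow> real \<times> real \<Rightarrow> real \<times> real) \<Rightarrow> nat \<Rightarrow> expression" where
  "xi_hat T j z = hat j (\<lambda>i. xi T (z i)) (\<lambda>i. fst (z i))"

end

theory Submission
  imports Defs
begin

text \<open>The recursion is the derivative at \<open>\<epsilon> = 0\<close> of the classical recursion for divided
  differences. Up to the factor \<open>j!\<close>, \<open>hat j w x\<close> is the leading coefficient of the polynomial
  of degree at most \<open>j\<close> that interpolates \<open>w\<close> at \<open>x\<^sub>0, \<dots>, x\<^sub>j\<close> (lemma \<open>hat_eq_coeff\<close>), and
  Neville's construction glues the interpolants at \<open>x\<^sub>0, \<dots>, x\<^sub>k\<close> and at \<open>x\<^sub>1, \<dots>, x\<^bsub>k+1\<^esub>\<close>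
  to the one at all \<open>k + 2\<close> nodes. Comparing leading coefficients gives (lemma \<open>u_hat_Suc\<close>)
  \<open>u_hat (k + 1) = (k + 1) / (x\<^bsub>k+1\<^esub> - x\<^sub>0) * (S - id) (u_hat k)\<close>.

  The transformed points have distinct abscissae for \<open>\<epsilon>\<close> near \<open>0\<close>, so this identity holds for
  them too and may be differentiated there. The derivative of the difference on the right gives the
  discrete derivative of the infinitesimal; the derivative of the denominator is the difference
  of the values of \<open>\<xi>\<close> at the last and the first point, and the quotient rule turns it into the
  correction term, in which the undifferentiated factor is again \<open>u_hat (k + 1)\<close>
  (lemma \<open>phi_hat_recursion\<close>).

  Since \<open>deriv\<close> has its rules only for differentiable functions, it remains to see that the
  coordinates of the moved points depend differentiably on \<open>\<epsilon>\<close> at \<open>0\<close>. This is the chain rule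
  through charts: the curve in a chart of the group, then the action in charts, then the change
  from an atlas chart to the given coordinates (lemma \<open>action_along_curve\<close>).\<close>

section \<open>Divided differences as leading coefficients\<close>

text \<open>Neville's construction. At the inner nodes both \<open>P\<close> and \<open>Q\<close> have the right value and the
  weights \<open>(x - x\<^sub>0)\<close> and \<open>-(x - x\<^bsub>j+1\<^esub>)\<close> sum to \<open>x\<^bsub>j+1\<^esub> - x\<^sub>0\<close>; at each end node one
  weight vanishes, and it is that of the polynomial about which nothing is known there.\<close>

lemma neville_step:
  fixes x w :: "nat \<Rightarrow> real" and P Q :: "real poly"
  assumes ne: "x 0 \<noteq> x (Suc j)"
    and P: "degree P \<le> j" "\<forall>i\<le>j. poly P (x i) = w i"
    and Q: "degree Q \<le> j" "\<forall>i\<le>j. poly Q (x (Suc i)) = w (Suc i)"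
  defines "R \<equiv> Polynomial.smult (1 / (x (Suc j) - x 0))
    ([:- x 0, 1:] * Q - [:- x (Suc j), 1:] * P)"
  shows "degree R \<le> Suc j"
    and "\<forall>i\<le>Suc j. poly R (x i) = w i"
    and "coeff R (Suc j) = (coeff Q j - coeff P j) / (x (Suc j) - x 0)"
proof -
  have lin: "degree ([:- a, 1:] * p) \<le> Suc j" if "degree p \<le> j" for a :: real and p
    using degree_mult_le[of "[:- a, 1:]" p] that by (simp del: mult_pCons_left)
  show "degree R \<le> Suc j"
    unfolding R_def by (intro order.trans[OF degree_smult_le] degree_diff_le lin P(1) Q(1))
next
  have "coeff P (Suc j) = 0" "coeff Q (Suc j) = 0"
    using P(1) Q(1) by (auto intro: coeff_eq_0)
  then show "coeff R (Suc j) = (coeff Q j - coeff P j) / (x (Suc j) - x 0)"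
    unfolding R_def by simp
next
  show "\<forall>i\<le>Suc j. poly R (x i) = w i"
  proof (intro allI impI)
    fix i assume i: "i \<le> Suc j"
    define d where "d = x (Suc j) - x 0"
    have d: "d \<noteq> 0" using ne by (simp add: d_def)
    then have R: "d * poly R (x i) =
        (x i - x 0) * poly Q (x i) - (x i - x (Suc j)) * poly P (x i)"
      unfolding R_def d_def[symmetric] by (simp add: left_diff_distrib)
    \<comment> \<open>Working with the multiple by \<open>d\<close> keeps the case analysis free of division.\<close>
    consider "i = 0" | "i = Suc j" | i' where "i = Suc i'" "i \<le> j"
      using i by (cases i) (auto simp: le_Suc_eq)
    then have "d * poly R (x i) = d * w i"
    proof cases
      case 1
      then have "poly P (x i) = w i" using P(2) by simp
      then show ?thesis unfolding R using 1 by (simp add: d_def algebra_simps)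
    next
      case 2
      then have "poly Q (x i) = w i" using Q(2) by simp
      then show ?thesis unfolding R using 2 by (simp add: d_def algebra_simps)
    next
      case 3
      then have "poly P (x i) = w i" "poly Q (x i) = w i" using P(2) Q(2) by auto
      then show ?thesis unfolding R by (simp add: d_def algebra_simps)
    qed
    then show "poly R (x i) = w i" using d by simp
  qed
qed

lemma interpolating_poly_exists:
  fixes x w :: "nat \<Rightarrow> real"
  assumes "inj_on x {..j}"
  shows "\<exists>P. degree P \<le> j \<and> (\<forall>i\<le>j. poly P (x i) = w i)"
  using assms
proof (induction j arbitrary: x w)
  case 0
  show ?case by (rule exI[of _ "[:w 0:]"]) simp
next
  case (Suc j)
  have "inj_on x {..j}" "inj_on (\<lambda>i. x (Suc i)) {..j}"
    using Suc.prems by (auto simp: inj_on_def)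
  from Suc.IH[OF this(1), of w] Suc.IH[OF this(2), of "\<lambda>i. w (Suc i)"]
  obtain P Q where PQ: "degree P \<le> j" "\<forall>i\<le>j. poly P (x i) = w i"
    "degree Q \<le> j" "\<forall>i\<le>j. poly Q (x (Suc i)) = w (Suc i)" by blast
  have "x 0 \<noteq> x (Suc j)" using Suc.prems by (auto simp: inj_on_def)
  from neville_step[where w = w, OF this PQ] show ?case by blast
qed

lemma poly_eq_coeff_sum:
  assumes "degree P \<le> j"
  shows "poly P (y :: real) = (\<Sum>a<j + 1. y ^ a * coeff P a)"
proof -
  have "poly P y = (\<Sum>a\<le>degree P. coeff P a * y ^ a)" by (rule poly_altdef)
  also have "\<dots> = (\<Sum>a\<le>j. coeff P a * y ^ a)"
    using assms by (intro sum.mono_neutral_left) (auto simp: coeff_eq_0)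
  finally show ?thesis by (simp add: mult.commute lessThan_Suc_atMost)
qed

text \<open>Interpolation makes the Vandermonde matrix invertible: the coefficients of the Lagrange
  basis polynomials are the columns of a right inverse.\<close>

lemma vandermonde_det_nonzero:
  assumes "inj_on x {..j}"
  shows "vandermonde_det j x \<noteq> 0"
proof -
  have "\<forall>l. \<exists>P. degree P \<le> j \<and> (\<forall>i\<le>j. poly P (x i) = (if i = l then 1 else 0))"
    by (rule allI interpolating_poly_exists[OF assms])+
  from choice[OF this] obtain P where P: "\<And>l. degree (P l) \<le> j"
    "\<And>l i. i \<le> j \<Longrightarrow> poly (P l) (x i) = (if i = l then 1 else 0)" by blast
  define V where "V = Matrix.mat (j + 1) (j + 1) (\<lambda>(i, c). x i ^ c)"
  define C where "C = Matrix.mat (j + 1) (j + 1) (\<lambda>(a, l). coeff (P l) a)"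
  have VC: "V \<in> carrier_mat (j + 1) (j + 1)" "C \<in> carrier_mat (j + 1) (j + 1)"
    unfolding V_def C_def by (rule mat_carrier)+
  have "V * C = 1\<^sub>m (j + 1)"
  proof (rule eq_matI)
    fix i l assume "i < dim_row (1\<^sub>m (j + 1))" "l < dim_col (1\<^sub>m (j + 1))"
    then have il: "i < j + 1" "l < j + 1" by auto
    then have "(V * C) $$ (i, l) = (\<Sum>a<j + 1. x i ^ a * coeff (P l) a)"
      unfolding V_def C_def by (simp add: scalar_prod_def atLeast0LessThan)
    also have "\<dots> = poly (P l) (x i)" by (rule poly_eq_coeff_sum[symmetric, OF P(1)])
    finally show "(V * C) $$ (i, l) = 1\<^sub>m (j + 1) $$ (i, l)" using il P(2)[of i l] by simp
  qed (simp_all add: V_def C_def)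
  then have "Determinant.det V * Determinant.det C = 1"
    using det_mult[OF VC] by (simp add: Determinant.det_one)
  then have "Determinant.det V \<noteq> 0" by auto
  then show ?thesis unfolding vandermonde_det_def V_def .
qed

text \<open>This is Cramer's rule for the leading coefficient. The column of values \<open>w\<^sub>i = P(x\<^sub>i)\<close> is
  the combination of the Vandermonde columns with the coefficients of \<open>P\<close>, so replacing the last
  column amounts to multiplication by the upper triangular matrix \<open>E\<close> below, whose diagonal is
  \<open>1, \<dots>, 1, coeff P j\<close>.\<close>

lemma hat_eq_coeff:
  assumes inj: "inj_on x {..j}" and deg: "degree P \<le> j"
    and P: "\<forall>i\<le>j. poly P (x i) = w i"
  shows "hat j w x = fact j * coeff P j"
proof -
  define V where "V = Matrix.mat (j + 1) (j + 1) (\<lambda>(i, c). x i ^ c)"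
  define R where "R = Matrix.mat (j + 1) (j + 1) (\<lambda>(i, c). if c = j then w i else x i ^ c)"
  define E where "E = Matrix.mat (j + 1) (j + 1)
    (\<lambda>(a, c). if c = j then coeff P a else if a = c then 1 else (0 :: real))"
  have VE: "V \<in> carrier_mat (j + 1) (j + 1)" "E \<in> carrier_mat (j + 1) (j + 1)"
    unfolding V_def E_def by auto
  have "V * E = R"
  proof (rule eq_matI)
    fix i c assume "i < dim_row R" "c < dim_col R"
    then have ic: "i < j + 1" "c < j + 1" unfolding R_def by auto
    then have VE_ic: "(V * E) $$ (i, c) =
        (\<Sum>a<j + 1. x i ^ a * (if c = j then coeff P a else if a = c then 1 else 0))"
      unfolding V_def E_def by (auto simp: scalar_prod_def atLeast0LessThan intro!: sum.cong)
    show "(V * E) $$ (i, c) = R $$ (i, c)"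
    proof (cases "c = j")
      case True
      then show ?thesis
        using ic VE_ic poly_eq_coeff_sum[OF deg, of "x i"] P unfolding R_def by simp
    next
      case False
      then have "(V * E) $$ (i, c) = (\<Sum>a<j + 1. if a = c then x i ^ a else 0)"
        unfolding VE_ic by (intro sum.cong) auto
      also have "\<dots> = x i ^ c" using ic by (subst sum.delta) auto
      finally show ?thesis using ic False unfolding R_def by simp
    qed
  qed (auto simp: V_def E_def R_def)
  then have "Determinant.det R = Determinant.det V * Determinant.det E"
    using det_mult[OF VE] by simp
  moreover have "Determinant.det E = coeff P j"
  proof -
    have "upper_triangular E" unfolding E_def by auto
    then have "Determinant.det E = prod_list (diag_mat E)"
      using VE(2) by (rule det_upper_triangular)
    also have "diag_mat E = map (\<lambda>a. if a = j then coeff P j else 1) [0..<j + 1]"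
      unfolding diag_mat_def E_def by auto
    also have "\<dots> = map (\<lambda>a. 1) [0..<j] @ [coeff P j]" by auto
    also have "prod_list \<dots> = coeff P j" by (simp add: map_replicate_const)
    finally show ?thesis .
  qed
  ultimately have "vandermonde_det_repl j w x = vandermonde_det j x * coeff P j"
    unfolding vandermonde_det_repl_def vandermonde_det_def V_def R_def by simp
  then show ?thesis unfolding hat_def using vandermonde_det_nonzero[OF inj] by simp
qed

lemma hat_0: "hat 0 w x = w 0"
  using hat_eq_coeff[of x 0 "[:w 0:]" w] by simp

lemma hat_Suc:
  assumes "inj_on x {..Suc j}"
  shows "hat (Suc j) w x =
    real (Suc j) / (x (Suc j) - x 0) * (hat j (\<lambda>i. w (Suc i)) (\<lambda>i. x (Suc i)) - hat j w x)"
proof -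
  have inj: "inj_on x {..j}" "inj_on (\<lambda>i. x (Suc i)) {..j}" and ne: "x 0 \<noteq> x (Suc j)"
    using assms by (auto simp: inj_on_def)
  from interpolating_poly_exists[OF inj(1), of w]
    interpolating_poly_exists[OF inj(2), of "\<lambda>i. w (Suc i)"]
  obtain P Q where P: "degree P \<le> j" "\<forall>i\<le>j. poly P (x i) = w i"
    and Q: "degree Q \<le> j" "\<forall>i\<le>j. poly Q (x (Suc i)) = w (Suc i)" by blast
  note R = neville_step[where w = w, OF ne P Q]
  show ?thesis
    unfolding hat_eq_coeff[OF assms R(1,2)] R(3)
      hat_eq_coeff[OF inj(1) P] hat_eq_coeff[OF inj(2) Q]
    by (simp add: field_simps)
qed

lemma u_hat_Suc:
  assumes "inj_on (\<lambda>i. fst (z i)) {..Suc j}"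
  shows "u_hat (Suc j) z =
    real (Suc j) / (fst (z (Suc j)) - fst (z 0)) * (u_hat j (\<lambda>i. z (Suc i)) - u_hat j z)"
  unfolding u_hat_def by (rule hat_Suc[OF assms])

text \<open>A family of points on curves is only known to start at \<open>z\<close> at the indices that belong to the
  expression, so equality of whole sequences is not available.\<close>

lemma u_hat_cong:
  assumes "\<forall>i\<le>j. z i = z' i"
  shows "u_hat j z = u_hat j z'"
proof -
  have "Matrix.mat (j + 1) (j + 1) (\<lambda>(i, c). fst (z i) ^ c) =
      Matrix.mat (j + 1) (j + 1) (\<lambda>(i, c). fst (z' i) ^ c)"
    "Matrix.mat (j + 1) (j + 1) (\<lambda>(i, c). if c = j then snd (z i) else fst (z i) ^ c) =
      Matrix.mat (j + 1) (j + 1) (\<lambda>(i, c). if c = j then snd (z' i) else fst (z' i) ^ c)"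
    using assms by (auto intro!: eq_matI)
  then show ?thesis
    by (simp only: u_hat_def hat_def vandermonde_det_repl_def vandermonde_det_def)
qed

section \<open>Divided differences along curves of points\<close>

lemma eventually_inj_along_curve:
  fixes x :: "real \<Rightarrow> nat \<Rightarrow> real"
  assumes "finite I" and cont: "\<And>i. i \<in> I \<Longrightarrow> isCont (\<lambda>t. x t i) a" and "inj_on (x a) I"
  shows "\<forall>\<^sub>F t in nhds a. inj_on (x t) I"
proof -
  have "\<forall>\<^sub>F t in nhds a. x t i \<noteq> x t l" if "i \<in> I" "l \<in> I" "i \<noteq> l" for i l
  proof -
    have "((\<lambda>t. x t i - x t l) \<longlongrightarrow> x a i - x a l) (at a)"
      using cont[OF that(1)] cont[OF that(2)] by (intro tendsto_diff) (simp_all add: isCont_def)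
    then have "((\<lambda>t. x t i - x t l) \<longlongrightarrow> x a i - x a l) (nhds a)"
      by (rule tendsto_at_iff_tendsto_nhds[THEN iffD1])
    moreover have "x a i - x a l \<noteq> 0" using assms(3) that by (auto simp: inj_on_def)
    ultimately have "\<forall>\<^sub>F t in nhds a. x t i - x t l \<noteq> 0" by (rule tendsto_imp_eventually_ne)
    then show ?thesis by simp
  qed
  then have "\<forall>\<^sub>F t in nhds a. \<forall>i\<in>I. \<forall>l\<in>I. i \<noteq> l \<longrightarrow> x t i \<noteq> x t l"
    by (intro eventually_ball_finite[OF assms(1)] ballI) auto
  then show ?thesis by eventually_elim (auto simp: inj_on_def)
qed

lemma differentiable_cong_ev:
  assumes "f differentiable (at a)" and "\<forall>\<^sub>F t in nhds a. f t = g t"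
  shows "g differentiable (at a)"
proof -
  from assms(2) obtain W where W: "open W" "a \<in> W" "\<And>t. t \<in> W \<Longrightarrow> f t = g t"
    unfolding eventually_nhds by blast
  from assms(1) obtain f' where "(f has_derivative f') (at a)" unfolding differentiable_def by blast
  then have "(g has_derivative f') (at a)"
    by (rule has_derivative_transform_within_open[OF _ W])
  then show ?thesis by (rule differentiableI)
qed

text \<open>The divided difference recursion reduces differentiability to that of the coordinates,
  without differentiating a determinant. It is only valid while the abscissae stay distinct, that
  is, for parameters near \<open>a\<close>, which is why it enters through an eventual equality.\<close>

lemma u_hat_differentiable_along_curve:
  fixes c :: "real \<Rightarrow> nat \<Rightarrow> real \<times> real"
  assumes "\<And>i. i \<le> j \<Longrightarrow> (\<lambda>t. c t i) differentiable (at a)"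
    and "inj_on (\<lambda>i. fst (c a i)) {..j}"
  shows "(\<lambda>t. u_hat j (c t)) differentiable (at a)"
  using assms
proof (induction j arbitrary: c)
  case 0
  then show ?case
    unfolding u_hat_def hat_0 by (auto simp: differentiable_def intro: has_derivative_snd)
next
  case (Suc j)
  have fst_diff: "(\<lambda>t. fst (c t i)) differentiable (at a)" if "i \<le> Suc j" for i
    using Suc.prems(1)[OF that] by (auto simp: differentiable_def intro: has_derivative_fst)
  have "inj_on (\<lambda>i. fst (c a i)) {..j}" "inj_on (\<lambda>i. fst (c a (Suc i))) {..j}"
    and ne: "fst (c a (Suc j)) \<noteq> fst (c a 0)"
    using Suc.prems(2) by (auto simp: inj_on_def)
  then have "(\<lambda>t. u_hat j (c t)) differentiable (at a)"
    "(\<lambda>t. u_hat j (\<lambda>i. c t (Suc i))) differentiable (at a)"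
    using Suc.IH[of c] Suc.IH[of "\<lambda>t i. c t (Suc i)"] Suc.prems(1) by auto
  then have diff: "(\<lambda>t. real (Suc j) / (fst (c t (Suc j)) - fst (c t 0)) *
      (u_hat j (\<lambda>i. c t (Suc i)) - u_hat j (c t))) differentiable (at a)"
    using ne by (intro differentiable_mult differentiable_divide differentiable_diff
        differentiable_const fst_diff) auto
  have "\<forall>\<^sub>F t in nhds a. inj_on (\<lambda>i. fst (c t i)) {..Suc j}"
    by (rule eventually_inj_along_curve[where x = "\<lambda>t i. fst (c t i)"])
      (use fst_diff Suc.prems(2) in \<open>auto intro: differentiable_imp_continuous_within\<close>)
  then have "\<forall>\<^sub>F t in nhds a. real (Suc j) / (fst (c t (Suc j)) - fst (c t 0)) *
      (u_hat j (\<lambda>i. c t (Suc i)) - u_hat j (c t)) = u_hat (Suc j) (c t)"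
    by eventually_elim (rule u_hat_Suc[symmetric])
  with diff show ?case by (rule differentiable_cong_ev)
qed

section \<open>The recursion for a family of transformations\<close>

lemma shift_funpow: "(shift ^^ n) w z = w (\<lambda>i. z (i + n))"
  by (induction n arbitrary: z) (simp_all add: shift_def)

text \<open>Here the group has disappeared: the recursion is the quotient rule applied to \<open>u_hat_Suc\<close>
  for any family of maps whose member at \<open>0\<close> fixes the sample points and along which these
  move differentiably at \<open>0\<close>.\<close>

lemma phi_hat_recursion:
  fixes T :: "real \<Rightarrow> real \<times> real \<Rightarrow> real \<times> real"
  assumes T0: "\<And>i. i \<le> Suc k \<Longrightarrow> T 0 (z i) = z i"
    and diff: "\<And>i. i \<le> Suc k \<Longrightarrow> (\<lambda>\<epsilon>. T \<epsilon> (z i)) differentiable (at 0)"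
    and inj: "inj_on (\<lambda>i. fst (z i)) {..Suc k}"
  shows "phi_hat T (Suc k) z =
      discrete_deriv k (phi_hat T k) z
      - u_hat (Suc k) z * (1 / (fst (z (Suc k)) - fst (z 0)) * (xi T (z (Suc k)) - xi T (z 0)))"
proof -
  define c where "c \<epsilon> i = T \<epsilon> (z i)" for \<epsilon> i
  define D A B where "D \<epsilon> = fst (c \<epsilon> (Suc k)) - fst (c \<epsilon> 0)"
    and "A \<epsilon> = u_hat k (\<lambda>i. c \<epsilon> (Suc i))" and "B \<epsilon> = u_hat k (c \<epsilon>)" for \<epsilon>
  have c_diff: "(\<lambda>\<epsilon>. c \<epsilon> i) differentiable (at 0)" if "i \<le> Suc k" for i
    using diff[OF that] unfolding c_def .
  have fst_diff: "(\<lambda>\<epsilon>. fst (c \<epsilon> i)) differentiable (at 0)" if "i \<le> Suc k" for i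
    using c_diff[OF that] by (auto simp: differentiable_def intro: has_derivative_fst)
  have c_eq: "c \<epsilon> = (\<lambda>i. T \<epsilon> (z i))" for \<epsilon>
    by (simp add: c_def fun_eq_iff)
  have c0: "c 0 i = z i" if "i \<le> Suc k" for i using T0[OF that] unfolding c_def .
  have inj0: "inj_on (\<lambda>i. fst (c 0 i)) {..Suc k}"
    using inj c0 by (simp add: inj_on_def)
  then have inj': "inj_on (\<lambda>i. fst (c 0 i)) {..k}" "inj_on (\<lambda>i. fst (c 0 (Suc i))) {..k}"
    and D0: "D 0 \<noteq> 0"
    unfolding D_def by (auto simp: inj_on_def)
  have A': "(A has_field_derivative deriv A 0) (at 0)"
    unfolding A_def
    using u_hat_differentiable_along_curve[where c = "\<lambda>\<epsilon> i. c \<epsilon> (Suc i)", OF _ inj'(2)] c_diff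
    by (auto simp: DERIV_deriv_iff_real_differentiable)
  have B': "(B has_field_derivative deriv B 0) (at 0)"
    unfolding B_def using u_hat_differentiable_along_curve[where c = c, OF _ inj'(1)] c_diff
    by (auto simp: DERIV_deriv_iff_real_differentiable)
  have D': "(D has_field_derivative xi T (z (Suc k)) - xi T (z 0)) (at 0)"
    unfolding D_def xi_def c_def[symmetric] using fst_diff[of "Suc k"] fst_diff[of 0]
    by (intro DERIV_diff) (auto simp: DERIV_deriv_iff_real_differentiable)
  have rec: "u_hat (Suc k) (c \<epsilon>) = real (Suc k) / D \<epsilon> * (A \<epsilon> - B \<epsilon>)"
    if "inj_on (\<lambda>i. fst (c \<epsilon> i)) {..Suc k}" for \<epsilon>
    unfolding A_def B_def D_def using that by (rule u_hat_Suc)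
  have "\<forall>\<^sub>F \<epsilon> in nhds 0. inj_on (\<lambda>i. fst (c \<epsilon> i)) {..Suc k}"
    by (rule eventually_inj_along_curve[where x = "\<lambda>\<epsilon> i. fst (c \<epsilon> i)"])
      (use fst_diff inj0 in \<open>auto intro: differentiable_imp_continuous_within\<close>)
  then have "\<forall>\<^sub>F \<epsilon> in nhds 0. u_hat (Suc k) (c \<epsilon>) = real (Suc k) / D \<epsilon> * (A \<epsilon> - B \<epsilon>)"
    by eventually_elim (rule rec)
  then have "phi_hat T (Suc k) z = deriv (\<lambda>\<epsilon>. real (Suc k) / D \<epsilon> * (A \<epsilon> - B \<epsilon>)) 0"
    unfolding phi_hat_def c_def[symmetric] by (rule deriv_cong_ev) simp
  also have "\<dots> = real (Suc k) / D 0 * (deriv A 0 - deriv B 0)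
      - real (Suc k) / D 0 * (A 0 - B 0) * (1 / D 0 * (xi T (z (Suc k)) - xi T (z 0)))"
    by (rule DERIV_imp_deriv)
      (use D0 in \<open>auto intro!: derivative_eq_intros A' B' D' simp: field_simps power2_eq_square\<close>)
  \<comment> \<open>Read backwards at the parameter \<open>0\<close>, the recursion identifies the undifferentiated factor.\<close>
  also have "real (Suc k) / D 0 * (A 0 - B 0) = u_hat (Suc k) (c 0)"
    using rec[OF inj0] by simp
  also have "\<dots> = u_hat (Suc k) z"
    by (rule u_hat_cong) (use c0 in auto)
  finally show ?thesis
    unfolding discrete_deriv_def shift_def phi_hat_def D_def A_def B_def
    by (simp add: c0) (simp add: c_eq)
qed

section \<open>Moving a point along a curve in the group\<close>

text \<open>A smooth map on an arbitrary set may have no derivative of its own, since it is only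
  locally the restriction of a smooth map on an open set. Along a curve that stays in the set, it can
  be replaced by such an extension, to which the chain rule applies.\<close>

lemma differentiable_along_curve:
  assumes "smooth_on S f" and c: "c differentiable (at a)" "c a \<in> S"
    and S: "\<forall>\<^sub>F t in nhds a. c t \<in> S"
  shows "(\<lambda>t. f (c t)) differentiable (at a)"
proof -
  have "\<exists>W F. open W \<and> c a \<in> W \<and> (\<forall>n. Ck_on n W F) \<and> (\<forall>y\<in>S \<inter> W. f y = F y)"
    using assms(1) c(2) unfolding smooth_on_def by (rule bspec)
  then obtain W F where W: "open W" "c a \<in> W" and Ck: "\<forall>n. Ck_on n W F"
    and F: "\<forall>y\<in>S \<inter> W. f y = F y" by (elim exE conjE)
  have "F differentiable (at (c a))" using W(2) Ck[THEN spec, of "Suc 0"] by simp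
  then have "(\<lambda>t. F (c t)) differentiable (at a)" using c(1) by (rule differentiable_compose)
  moreover have "\<forall>\<^sub>F t in nhds a. F (c t) = f (c t)"
  proof -
    have "isCont c a" using c(1) by (rule differentiable_imp_continuous_within)
    then have "\<forall>\<^sub>F t in nhds a. c t \<in> W"
      using W(1,2) topological_tendstoD[of c "c a" "nhds a" W]
      by (simp add: isCont_def tendsto_at_iff_tendsto_nhds)
    with S show ?thesis by eventually_elim (simp add: F)
  qed
  ultimately show ?thesis by (rule differentiable_cong_ev)
qed

lemma eventually_in_openin_along_curve:
  assumes "continuous_map (top_of_set J) X c" "open J" "a \<in> J" "openin X A" "c a \<in> A"
  shows "\<forall>\<^sub>F t in nhds a. c t \<in> A"
proof -
  have "openin (top_of_set J) {t \<in> J. c t \<in> A}"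
    using openin_continuous_map_preimage[OF assms(1,4)] by simp
  then have "open {t \<in> J. c t \<in> A}" using assms(2) by (simp add: openin_open_eq)
  then have "\<forall>\<^sub>F t in nhds a. t \<in> {t \<in> J. c t \<in> A}"
    using assms(3,5) by (intro eventually_nhds_in_open) auto
  then show ?thesis by eventually_elim simp
qed

lemma is_chart_inj_on:
  assumes "is_chart M U \<phi>"
  shows "inj_on \<phi> U"
proof -
  have "U \<subseteq> topspace (top_of M)"
    using assms openin_subset by (auto simp: is_chart_def)
  moreover have "inj_on \<phi> (topspace (subtopology (top_of M) U))"
    by (rule homeomorphic_imp_injective_map[where Y = "top_of_set (\<phi> ` U)"])
      (use assms in \<open>simp add: is_chart_def\<close>)
  ultimately show ?thesis by (simp add: inf.absorb2)
qed

lemma chart_around: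
  assumes "smooth_manifold M" "p \<in> topspace (top_of M)"
  obtains V \<psi> where "(V, \<psi>) \<in> atlas M" "is_chart M V \<psi>" "p \<in> V"
proof -
  have charts: "\<forall>(U, \<phi>)\<in>atlas M. is_chart M U \<phi>"
    and cover: "topspace (top_of M) = (\<Union>(U, \<phi>)\<in>atlas M. U)"
    using assms(1) unfolding smooth_manifold_def by simp_all
  obtain V \<psi> where "(V, \<psi>) \<in> atlas M" "p \<in> V" using assms(2) unfolding cover by auto
  moreover from bspec[OF charts this(1)] have "is_chart M V \<psi>" by simp
  ultimately show ?thesis using that by blast
qed

lemma smooth_mapD:
  assumes "smooth_map M N f"
  shows "continuous_map (top_of M) (top_of N) f"
    and "(U, \<phi>) \<in> atlas M \<Longrightarrow> (V, \<psi>) \<in> atlas N \<Longrightarrow>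
      smooth_on (\<phi> ` (U \<inter> f -` V)) (\<psi> \<circ> f \<circ> inv_into U \<phi>)"
proof -
  show "continuous_map (top_of M) (top_of N) f" using assms by (simp add: smooth_map_def)
  assume U: "(U, \<phi>) \<in> atlas M" and V: "(V, \<psi>) \<in> atlas N"
  have "\<forall>(U, \<phi>)\<in>atlas M. \<forall>(V, \<psi>)\<in>atlas N.
      smooth_on (\<phi> ` (U \<inter> f -` V)) (\<psi> \<circ> f \<circ> inv_into U \<phi>)"
    using assms by (simp add: smooth_map_def)
  from bspec[OF bspec[OF this U, unfolded prod.case] V]
  show "smooth_on (\<phi> ` (U \<inter> f -` V)) (\<psi> \<circ> f \<circ> inv_into U \<phi>)" by simp
qed

text \<open>Smoothness of the action is a statement about atlas charts, whereas \<open>\<phi>\<close> merely belongs to the maximal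
  atlas. Hence the detour: take a chart \<open>\<psi>\<close> at the identity of the group and an atlas chart \<open>\<alpha>\<close>
  at \<open>p\<close>. The orbit curve starts at \<open>p\<close>, so it remains for small parameters in the domains of both
  \<open>\<alpha>\<close> and \<open>\<phi>\<close>; it is differentiable in \<open>\<alpha>\<close> by composition with \<open>\<psi> \<circ> \<gamma>\<close>, and then in \<open>\<phi>\<close>
  by compatibility of charts.\<close>

lemma action_along_curve:
  fixes G :: "('g, 'c) monoid_scheme"
    and L :: "('g, 'e::euclidean_space) manifold"
    and M :: "('m, 'f::euclidean_space) manifold"
  assumes L: "lie_group G L" and M: "smooth_manifold M"
    and act: "smooth_action G L M act"
    and coord: "local_coordinates M U \<phi>"
    and J: "open J" "0 \<in> J"
    and \<gamma>: "smooth_map (open_line J) L \<gamma>" "\<gamma> 0 = \<one>\<^bsub>G\<^esub>"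
    and p: "p \<in> U"
  shows "act (\<gamma> 0) p = p" and "(\<lambda>\<epsilon>. \<phi> (act (\<gamma> \<epsilon>) p)) differentiable (at 0)"
proof -
  have U: "openin (top_of M) U"
    using coord by (auto simp: local_coordinates_def is_chart_def)
  have pM: "p \<in> topspace (top_of M)" using p openin_subset[OF U] by blast
  have "group_action G (topspace (top_of M)) act" using act by (simp add: smooth_action_def)
  from group_action.id_eq_one[OF this] show fix0: "act (\<gamma> 0) p = p"
    using pM \<gamma>(2) by (auto dest: fun_cong[of _ _ p])
  have L_manifold: "smooth_manifold L" using L by (simp add: lie_group_def)
  have "\<one>\<^bsub>G\<^esub> \<in> topspace (top_of L)"
    using L by (simp add: lie_group_def group.is_monoid)
  then have "\<gamma> 0 \<in> topspace (top_of L)" by (simp only: \<gamma>(2))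
  from chart_around[OF L_manifold this] obtain V \<psi>
    where V: "(V, \<psi>) \<in> atlas L" "is_chart L V \<psi>" "\<gamma> 0 \<in> V" .
  obtain A \<alpha> where A: "(A, \<alpha>) \<in> atlas M" "is_chart M A \<alpha>" "p \<in> A"
    by (rule chart_around[OF M pM])
  have open_VA: "openin (top_of L) V" "openin (top_of M) A"
    using V(2) A(2) by (auto simp: is_chart_def)
  have inj: "inj_on \<psi> V" "inj_on \<alpha> A" using V(2) A(2) by (auto intro: is_chart_inj_on)

  have cont_\<gamma>: "continuous_map (top_of_set J) (top_of L) \<gamma>"
    using smooth_mapD(1)[OF \<gamma>(1)] by (simp add: open_line_def)
  have act_smooth: "smooth_map (prod_manifold L M) M (\<lambda>(g, q). act g q)"
    using act by (simp add: smooth_action_def)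
  then have "continuous_map (prod_topology (top_of L) (top_of M)) (top_of M) (\<lambda>(g, q). act g q)"
    using smooth_mapD(1)[OF act_smooth] by (simp add: prod_manifold_def)
  from continuous_map_compose[OF _ this, of "top_of_set J" "\<lambda>\<epsilon>. (\<gamma> \<epsilon>, p)"]
  have cont_act: "continuous_map (top_of_set J) (top_of M) (\<lambda>\<epsilon>. act (\<gamma> \<epsilon>) p)"
    using cont_\<gamma> pM by (auto simp: continuous_map_pairwise o_def)
  note ev = eventually_in_openin_along_curve[OF _ J]
  have ev_V: "\<forall>\<^sub>F \<epsilon> in nhds 0. \<gamma> \<epsilon> \<in> V" using ev[OF cont_\<gamma> open_VA(1)] V(3) .
  have ev_A: "\<forall>\<^sub>F \<epsilon> in nhds 0. act (\<gamma> \<epsilon>) p \<in> A"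
    by (rule ev[OF cont_act open_VA(2)]) (simp add: fix0 A(3))
  have ev_U: "\<forall>\<^sub>F \<epsilon> in nhds 0. act (\<gamma> \<epsilon>) p \<in> U"
    by (rule ev[OF cont_act U]) (simp add: fix0 p)
  have ev_J: "\<forall>\<^sub>F \<epsilon> in nhds 0. \<epsilon> \<in> J" using J by (rule eventually_nhds_in_open)

  have \<psi>\<gamma>: "(\<lambda>\<epsilon>. \<psi> (\<gamma> \<epsilon>)) differentiable (at 0)"
  proof -
    have "smooth_on (id ` (J \<inter> \<gamma> -` V)) (\<psi> \<circ> \<gamma> \<circ> inv_into J id)"
      by (rule smooth_mapD(2)[OF \<gamma>(1) _ V(1)]) (simp add: open_line_def)
    then have "(\<lambda>\<epsilon>. (\<psi> \<circ> \<gamma> \<circ> inv_into J id) \<epsilon>) differentiable (at 0)"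
    proof (rule differentiable_along_curve)
      show "\<forall>\<^sub>F \<epsilon> in nhds 0. \<epsilon> \<in> id ` (J \<inter> \<gamma> -` V)"
        using ev_J ev_V by eventually_elim simp
    qed (use J V(3) in auto)
    moreover have "\<forall>\<^sub>F \<epsilon> in nhds 0. (\<psi> \<circ> \<gamma> \<circ> inv_into J id) \<epsilon> = \<psi> (\<gamma> \<epsilon>)"
      using ev_J
    proof eventually_elim
      case (elim \<epsilon>)
      then have "inv_into J id \<epsilon> = \<epsilon>" using inv_into_f_f[of id J \<epsilon>] by simp
      then show ?case by simp
    qed
    ultimately show ?thesis by (rule differentiable_cong_ev)
  qed

  have \<alpha>_act: "(\<lambda>\<epsilon>. \<alpha> (act (\<gamma> \<epsilon>) p)) differentiable (at 0)"
  proof -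
    let ?S = "map_prod \<psi> \<alpha> ` (V \<times> A \<inter> (\<lambda>(g, q). act g q) -` A)"
    let ?f = "\<alpha> \<circ> (\<lambda>(g, q). act g q) \<circ> inv_into (V \<times> A) (map_prod \<psi> \<alpha>)"
    have "(V \<times> A, map_prod \<psi> \<alpha>) \<in> atlas (prod_manifold L M)"
      using V(1) A(1) by (auto simp: prod_manifold_def)
    then have smooth: "smooth_on ?S ?f" by (rule smooth_mapD(2)[OF act_smooth _ A(1)])
    have in_S: "(\<psi> g, \<alpha> p) \<in> ?S" if "g \<in> V" "act g p \<in> A" for g
      using that A(3) by (intro image_eqI[of _ _ "(g, p)"]) auto
    have "(\<lambda>\<epsilon>. ?f (\<psi> (\<gamma> \<epsilon>), \<alpha> p)) differentiable (at 0)"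
      using smooth
    proof (rule differentiable_along_curve)
      show "(\<lambda>\<epsilon>. (\<psi> (\<gamma> \<epsilon>), \<alpha> p)) differentiable (at 0)" using \<psi>\<gamma> by simp
      show "(\<psi> (\<gamma> 0), \<alpha> p) \<in> ?S" using V(3) A(3) fix0 by (intro in_S) auto
      show "\<forall>\<^sub>F \<epsilon> in nhds 0. (\<psi> (\<gamma> \<epsilon>), \<alpha> p) \<in> ?S"
        using ev_V ev_A by eventually_elim (rule in_S)
    qed
    moreover have "\<forall>\<^sub>F \<epsilon> in nhds 0. ?f (\<psi> (\<gamma> \<epsilon>), \<alpha> p) = \<alpha> (act (\<gamma> \<epsilon>) p)"
      using ev_V
    proof eventually_elim
      case (elim \<epsilon>)
      have "inv_into (V \<times> A) (map_prod \<psi> \<alpha>) (map_prod \<psi> \<alpha> (\<gamma> \<epsilon>, p)) = (\<gamma> \<epsilon>, p)"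
        using elim A(3) by (intro inv_into_f_f map_prod_inj_on inj) auto
      then show ?case by simp
    qed
    ultimately show ?thesis by (rule differentiable_cong_ev)
  qed

  show "(\<lambda>\<epsilon>. \<phi> (act (\<gamma> \<epsilon>) p)) differentiable (at 0)"
  proof -
    have "\<forall>(V, \<psi>)\<in>atlas M. smoothly_compatible U \<phi> V \<psi>"
      using coord by (simp add: local_coordinates_def)
    from bspec[OF this A(1)] have "smooth_on (\<alpha> ` (U \<inter> A)) (\<phi> \<circ> inv_into A \<alpha>)"
      by (simp add: smoothly_compatible_def)
    then have "(\<lambda>\<epsilon>. (\<phi> \<circ> inv_into A \<alpha>) (\<alpha> (act (\<gamma> \<epsilon>) p))) differentiable (at 0)"
      using \<alpha>_act
    proof (rule differentiable_along_curve)
      show "\<alpha> (act (\<gamma> 0) p) \<in> \<alpha> ` (U \<inter> A)" using fix0 p A(3) by simp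
      show "\<forall>\<^sub>F \<epsilon> in nhds 0. \<alpha> (act (\<gamma> \<epsilon>) p) \<in> \<alpha> ` (U \<inter> A)"
        using ev_U ev_A by eventually_elim simp
    qed
    moreover have "\<forall>\<^sub>F \<epsilon> in nhds 0.
        (\<phi> \<circ> inv_into A \<alpha>) (\<alpha> (act (\<gamma> \<epsilon>) p)) = \<phi> (act (\<gamma> \<epsilon>) p)"
      using ev_A by eventually_elim (simp add: inv_into_f_f[OF inj(2)])
    ultimately show ?thesis by (rule differentiable_cong_ev)
  qed
qed

theorem theorem4p3:
  fixes G :: "('g, 'c) monoid_scheme"
    and L :: "('g, 'e::euclidean_space) manifold"
    and M :: "('m, real \<times> real) manifold"
    and act :: "'g \<Rightarrow> 'm \<Rightarrow> 'm"
    and U :: "'m set" and \<phi> :: "'m \<Rightarrow> real \<times> real"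
    and J :: "real set" and \<gamma> :: "real \<Rightarrow> 'g"
    and k :: nat and z :: "nat \<Rightarrow> real \<times> real"
    and T :: "real \<Rightarrow> real \<times> real \<Rightarrow> real \<times> real"
  assumes "lie_group G L"
    and "smooth_manifold M" and "model M = UNIV"
    and "smooth_action G L M act"
    and "local_coordinates M U \<phi>"
    and "open J" and "is_interval J" and "0 \<in> J"
    and "smooth_map (open_line J) L \<gamma>" and "\<gamma> 0 = \<one>\<^bsub>G\<^esub>"
    and "\<forall>i\<le>k+1. z i \<in> \<phi> ` U"
    and "inj_on (\<lambda>i. fst (z i)) {0..k+1}"
    and "T = moved act U \<phi> \<gamma>"
  shows "phi_hat T (k + 1) z =
      discrete_deriv k (phi_hat T k) z
      - u_hat (k + 1) z *
        (1 / (fst (z (k + 1)) - fst (z 0)) *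
          ((shift ^^ (k + 1)) (xi_hat T 0) z - xi_hat T 0 z))"
proof -
  note moved = action_along_curve[OF assms(1,2,4,5,6,8,9,10)]
  have U: "inv_into U \<phi> (z i) \<in> U" if "i \<le> Suc k" for i
    using assms(11) that by (auto intro: inv_into_into)
  have "T 0 (z i) = z i" if "i \<le> Suc k" for i
    using moved(1)[OF U[OF that]] assms(11) that by (simp add: assms(13) moved_def f_inv_into_f)
  moreover have "(\<lambda>\<epsilon>. T \<epsilon> (z i)) differentiable (at 0)" if "i \<le> Suc k" for i
    using moved(2)[OF U[OF that]] by (simp add: assms(13) moved_def)
  moreover have "inj_on (\<lambda>i. fst (z i)) {..Suc k}"
    using assms(12) by (simp add: atLeast0AtMost)
  ultimately show ?thesis
    using phi_hat_recursion[of k T z] by (simp add: shift_funpow xi_hat_def hat_0 del: funpow.simps)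
qed

end
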